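(* With the precedence $>$ described in the context, every rule of $\mathcal{H}_{\mathrm{lab}}\cup\mathcal{D}\mathrm{ec}$ is oriented by $>_{\mathrm{acmpo}}$, i.e. $\mathcal{H}_{\mathrm{lab}}\cup\mathcal{D}\mathrm{ec}\subseteq{>_{\mathrm{acmpo}}}$.
   Context: Let $\mathbb{O}$ be the set of ordinals below $\varepsilon_0$. The signature consists of constants $\mathsf{h},\mathsf{0}$; unary $\mathsf{I},\mathsf{E},\mathsf{s}$; binary $\mathsf{C},\mathsf{D}$; binary $\mathsf{A}_v,\mathsf{B}_v$ for every $v\in\mathbb{O}$; and the binary AC symbol $\mid$ (written infix), which is the only AC symbol. The infinite TRS $\mathcal{H}_{\mathrm{lab}}$ consists of, for all $v\in\mathbb{O}$: (1) $\mathsf{A}_\omega(n,\mathsf{I}(\mathsf{h}))\to\mathsf{A}_1(\mathsf{s}(n),\mathsf{h})$; (2) $\mathsf{A}_{\omega^{v+1}}(n,\mathsf{I}(\mathsf{h}\mid x))\to\mathsf{A}_{\omega^v}(\mathsf{s}(n),\mathsf{I}(x))$; (3) $\mathsf{A}_{\omega^v}(n,\mathsf{I}(x))\to\mathsf{B}_{\omega^v}(n,\mathsf{D}(\mathsf{s}(n),\mathsf{I}(x)))$; (4) $\mathsf{C}(\mathsf{0},x)\to\mathsf{E}(x)$; (5) $\mathsf{C}(\mathsf{s}(n),x)\to x\mid\mathsf{C}(n,x)$; (6) $\mathsf{I}(\mathsf{E}(x)\mid y)\to\mathsf{E}(\mathsf{I}(x\mid y))$; (7) $\mathsf{I}(\mathsf{E}(x))\to\mathsf{E}(\mathsf{I}(x))$;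 (8) $\mathsf{D}(n,\mathsf{I}(\mathsf{I}(x)))\to\mathsf{I}(\mathsf{D}(n,\mathsf{I}(x)))$; (9) $\mathsf{D}(n,\mathsf{I}(\mathsf{I}(x)\mid y))\to\mathsf{I}(\mathsf{D}(n,\mathsf{I}(x))\mid y)$; (10) $\mathsf{D}(n,\mathsf{I}(\mathsf{I}(\mathsf{h}\mid x)\mid y))\to\mathsf{I}(\mathsf{C}(n,\mathsf{I}(x))\mid y)$; (11) $\mathsf{D}(n,\mathsf{I}(\mathsf{I}(\mathsf{h}\mid x)))\to\mathsf{I}(\mathsf{C}(n,\mathsf{I}(x)))$; (12) $\mathsf{D}(n,\mathsf{I}(\mathsf{I}(\mathsf{h})\mid y))\to\mathsf{I}(\mathsf{C}(n,\mathsf{h})\mid y)$; (13) $\mathsf{D}(n,\mathsf{I}(\mathsf{I}(\mathsf{h})))\to\mathsf{I}(\mathsf{C}(n,\mathsf{h}))$; (14) $\mathsf{B}_{v+1}(n,\mathsf{E}(x))\to\mathsf{A}_v(\mathsf{s}(n),x)$. $\mathcal{D}\mathrm{ec}$ consists of $\mathsf{A}_v(n,x)\to\mathsf{A}_w(n,x)$ and $\mathsf{B}_v(n,x)\to\mathsf{B}_w(n,x)$ for all $v,w\in\mathbb{O}$ with $v>w$. The precedence $>$ is the transitive closure of: $\mathsf{A}_v>\mathsf{A}_w$ and $\mathsf{B}_v>\mathsf{B}_w$ for $v>w$; $\mathsf{B}_{v+1}>\mathsf{A}_v>\mathsf{B}_v$ for all $v\in\mathbb{O}$; $\mathsf{B}_0>\mathsf{s}>\mathsf{D}>\mathsf{C}>\mathsf{I}>\mathsf{E}>{\mid}$.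 $=_{\mathrm{AC}}$ is the congruence generated by associativity and commutativity of $\mid$. $\mathrm{root}(t)$ is $t$ for variables and $f$ for $t=f(t_1,\dots,t_n)$. For non-variable $t=f(t_1,\dots,t_n)$, $\mathrm{TF}(t)=\mathrm{TF}_f(t_1)\uplus\cdots\uplus\mathrm{TF}_f(t_n)$, with $\mathrm{TF}_f(u)=\mathrm{TF}_f(u_1)\uplus\mathrm{TF}_f(u_2)$ if $u=f(u_1,u_2)$ and $f$ is AC, and $\mathrm{TF}_f(u)=\{u\}$ otherwise. $=_{\mathrm{AC}}^{\mathrm{mul}}$: $\varnothing=_{\mathrm{AC}}^{\mathrm{mul}}\varnothing$, $\{s\}\uplus M=_{\mathrm{AC}}^{\mathrm{mul}}\{t\}\uplus N$ if $s=_{\mathrm{AC}}t$ and $M=_{\mathrm{AC}}^{\mathrm{mul}}N$. $s>_{\mathrm{acmpo}}t$ iff $s$ is not a variable and one of: (1) some $s'\in\mathrm{TF}(s)$ has $s'>_{\mathrm{acmpo}}t$ or $s'=_{\mathrm{AC}}t$; (2) $\mathrm{root}(s)>\mathrm{root}(t)$ and $s>_{\mathrm{acmpo}}t'$ for all $t'\in\mathrm{TF}(t)$; (3) $\mathrm{root}(s)=\mathrm{root}(t)$ and there are multisets with $\mathrm{TF}(s)=S_1\uplus S_2$, $\mathrm{TF}(t)=T_1\uplus T_2$, $S_1=_{\mathrm{AC}}^{\mathrm{mul}}T_1$, $S_2\ne\varnothing$, and each $t'\in T_2$ has some $s'\in S_2$ with $s'>_{\mathrm{acmpo}}t'$. 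*)

theory Defs
  imports Main "HOL-Library.Multiset"
begin

text \<open>
  Ordinals below \<open>\<epsilon>\<^sub>0\<close>, given by their Cantor normal forms: \<open>OZ\<close> is 0 and
  \<open>OP a b\<close> is \<open>\<omega>\<^sup>a + b\<close>. The predicate \<open>nf\<close> demands that the exponents are
  weakly decreasing, hereditarily; every ordinal below \<open>\<epsilon>\<^sub>0\<close> has exactly one
  such form, and on these forms the order of ordinals is lexicographic.
\<close>

datatype cnf = OZ | OP cnf cnf

fun cnf_less :: "cnf \<Rightarrow> cnf \<Rightarrow> bool" where
  "cnf_less x OZ = False"
| "cnf_less OZ (OP c d) = True"
| "cnf_less (OP a b) (OP c d) = (cnf_less a c \<or> a = c \<and> cnf_less b d)"

fun lead_le :: "cnf \<Rightarrow> cnf \<Rightarrow> bool" where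
  "lead_le OZ a = True"
| "lead_le (OP c d) a = (\<not> cnf_less a c)"

fun nf :: "cnf \<Rightarrow> bool" where
  "nf OZ = True"
| "nf (OP a b) = (nf a \<and> nf b \<and> lead_le b a)"

fun cnf_add :: "cnf \<Rightarrow> cnf \<Rightarrow> cnf" where
  "cnf_add OZ y = y"
| "cnf_add (OP a b) OZ = OP a b"
| "cnf_add (OP a b) (OP c d) =
     (if cnf_less a c then OP c d else OP a (cnf_add b (OP c d)))"

lemma cnf_less_irrefl [simp]: "\<not> cnf_less x x"
  by (induction x) auto

lemma cnf_less_trans: "cnf_less x y \<Longrightarrow> cnf_less y z \<Longrightarrow> cnf_less x z"
proof (induction x arbitrary: y z)
  case OZ then show ?case by (cases y; cases z) auto
next
  case (OP a b)
  show ?case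
  proof (cases y; cases z)
    fix c d e f assume "y = OP c d" "z = OP e f"
    then show ?thesis using OP.prems OP.IH(1)[of c e] OP.IH(2)[of d f] by auto
  qed (use OP.prems in auto)
qed

lemma cnf_less_linear: "cnf_less x y \<or> x = y \<or> cnf_less y x"
proof (induction x arbitrary: y)
  case OZ then show ?case by (cases y) auto
next
  case (OP a b)
  show ?case
  proof (cases y)
    case (OP c d)
    then show ?thesis using OP.IH(1)[of c] OP.IH(2)[of d] by auto
  qed auto
qed

lemma cnf_add_OZ [simp]: "cnf_add x OZ = x"
  by (cases x) auto

lemma lead_le_add: "lead_le x a \<Longrightarrow> lead_le y a \<Longrightarrow> lead_le (cnf_add x y) a"
  by (cases x; cases y) auto

lemma lead_le_add_right: "lead_le (cnf_add x y) a \<Longrightarrow> lead_le y a"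
proof (cases x; cases y)
  fix c d e f
  assume *: "lead_le (cnf_add x y) a" "x = OP c d" "y = OP e f"
  then show ?thesis
    using cnf_less_trans[of a e c] cnf_less_linear[of c e]
    by (auto split: if_splits)
qed auto

lemma nf_add: "nf x \<Longrightarrow> nf y \<Longrightarrow> nf (cnf_add x y)"
proof (induction x)
  case OZ then show ?case by simp
next
  case (OP a b)
  then show ?case by (cases y) (auto intro!: lead_le_add)
qed

lemma lead_less:
  assumes "lead_le x c" "cnf_less c a" shows "cnf_less x (OP a b)"
proof (cases x)
  case (OP e f)
  then show ?thesis using assms cnf_less_linear[of c e] cnf_less_trans[of e c a] by auto
qed auto

definition nf_less_rel :: "(cnf \<times> cnf) set" where
  "nf_less_rel = {(x, y). nf x \<and> nf y \<and> cnf_less x y}"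

lemma acc_OP:
  assumes "a \<in> Wellfounded.acc nf_less_rel" "b \<in> Wellfounded.acc nf_less_rel" "nf (OP a b)"
  shows "OP a b \<in> Wellfounded.acc nf_less_rel"
  using assms
proof (induction a arbitrary: b rule: acc_induct_rule)
  case (1 a)
  note IH1 = 1(2)
  show ?case using 1(3,4)
  proof (induction b rule: acc_induct_rule)
    case (1 b)
    note IH2 = 1(2)
    have "cnf_less y (OP a b) \<Longrightarrow> nf y \<Longrightarrow> y \<in> Wellfounded.acc nf_less_rel" for y
    proof (induction y)
      case OZ
      show ?case by (rule accI) (simp add: nf_less_rel_def)
    next
      case (OP c d)
      show ?case
      proof (cases "cnf_less c a")
        case True
        have "cnf_less d (OP a b)" using OP(4) True by (auto intro: lead_less)
        then have "d \<in> Wellfounded.acc nf_less_rel" using OP by simp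
        then show ?thesis
          using IH1[of c d] True OP(4) 1(3) by (auto simp: nf_less_rel_def)
      next
        case False
        then have "c = a" "cnf_less d b" using OP by auto
        then show ?thesis using IH2[of d] OP(4) 1(3) by (auto simp: nf_less_rel_def)
      qed
    qed
    then show ?case by - (rule accI, auto simp: nf_less_rel_def)
  qed
qed

lemma nf_acc: "nf x \<Longrightarrow> x \<in> Wellfounded.acc nf_less_rel"
proof (induction x)
  case OZ
  show ?case by (rule accI) (simp add: nf_less_rel_def)
next
  case (OP a b)
  then show ?case by (intro acc_OP) auto
qed

lemma wf_nf_less_rel: "wf nf_less_rel"
proof (rule acc_wfI, rule allI)
  fix x show "x \<in> Wellfounded.acc nf_less_rel"
  proof (cases "nf x")
    case False
    then show ?thesis by - (rule accI, auto simp: nf_less_rel_def)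
  qed (rule nf_acc)
qed

typedef eps0 = "{x. nf x}"
  by (rule exI[of _ OZ]) simp

setup_lifting type_definition_eps0

instantiation eps0 :: "{linorder, zero, one, plus}"
begin

lift_definition less_eps0 :: "eps0 \<Rightarrow> eps0 \<Rightarrow> bool" is cnf_less .

definition less_eq_eps0 :: "eps0 \<Rightarrow> eps0 \<Rightarrow> bool" where
  "less_eq_eps0 x y \<longleftrightarrow> x < y \<or> x = y"

lift_definition zero_eps0 :: eps0 is OZ by simp

lift_definition one_eps0 :: eps0 is "OP OZ OZ" by simp

lift_definition plus_eps0 :: "eps0 \<Rightarrow> eps0 \<Rightarrow> eps0" is cnf_add by (rule nf_add)

instance
proof
  fix x y z :: eps0
  have tr: "u < v \<Longrightarrow> v < w \<Longrightarrow> u < w" for u v w :: eps0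
    by transfer (rule cnf_less_trans)
  have ir: "\<not> u < u" for u :: eps0 by transfer simp
  show "(x < y) = (x \<le> y \<and> \<not> y \<le> x)"
    unfolding less_eq_eps0_def using ir[of x] tr[of x y x] by blast
  show "x \<le> x" unfolding less_eq_eps0_def by simp
  show "x \<le> y \<Longrightarrow> y \<le> z \<Longrightarrow> x \<le> z" unfolding less_eq_eps0_def using tr by blast
  show "x \<le> y \<Longrightarrow> y \<le> x \<Longrightarrow> x = y" unfolding less_eq_eps0_def using ir[of x] tr[of x y x] by blast
  have "x < y \<or> x = y \<or> y < x" by transfer (rule cnf_less_linear)
  then show "x \<le> y \<or> y \<le> x" unfolding less_eq_eps0_def by blast
qed

end

instance eps0 :: wellorder
proof
  fix P :: "eps0 \<Rightarrow> bool" and a :: eps0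
  assume step: "\<And>x. (\<And>y. y < x \<Longrightarrow> P y) \<Longrightarrow> P x"
  have "wf (inv_image nf_less_rel Rep_eps0)" by (intro wf_inv_image wf_nf_less_rel)
  then show "P a"
  proof (induction a rule: wf_induct_rule)
    case (less x)
    show ?case
    proof (rule step)
      fix y assume "y < x"
      then show "P y"
        using less Rep_eps0[of x] Rep_eps0[of y]
        by (auto simp: nf_less_rel_def less_eps0.rep_eq)
    qed
  qed
qed

lift_definition omega_pow :: "eps0 \<Rightarrow> eps0" is "\<lambda>a. OP a OZ" by simp

definition omega :: eps0 where
  "omega = omega_pow 1"

text \<open>
  The following facts, together with the well-order instance, determine \<open>eps0\<close>
  up to isomorphism as the ordinals below \<open>\<epsilon>\<^sub>0\<close>, with \<open>+\<close> being ordinal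
  addition and \<open>omega_pow v\<close> being \<open>\<omega>\<^sup>v\<close>: identifying an ordinal with the set
  of smaller ones, they say that \<open>v + w = v \<union> {v + u | u < w}\<close>, that
  \<open>\<omega>\<^sup>v = sup ({1} \<union> {\<omega>\<^sup>w \<cdot> n | w < v, n < \<omega>})\<close>, and that the towers
  \<open>0, \<omega>\<^sup>0, \<omega>\<^bsup>\<omega>\<^sup>0\<^esup>, \<dots>\<close> are cofinal.
\<close>

lemma eps0_zero_le: "(0::eps0) \<le> x"
proof -
  have "0 = x \<or> 0 < x"
  proof (transfer)
    fix x show "OZ = x \<or> cnf_less OZ x" by (cases x) auto
  qed
  then show ?thesis by auto
qed

lemma eps0_less_one_iff: "x < (1::eps0) \<longleftrightarrow> x = 0"
proof (transfer)
  fix x show "cnf_less x (OP OZ OZ) \<longleftrightarrow> x = OZ" by (cases x) auto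
qed

lemma cnf_add_mono: "cnf_less u w \<Longrightarrow> cnf_less (cnf_add v u) (cnf_add v w)"
proof (induction v)
  case (OP a b)
  then show ?case
    by (cases u; cases w) (auto dest: cnf_less_trans)
qed simp

lemma cnf_diff_ex:
  "nf v \<Longrightarrow> nf x \<Longrightarrow> \<not> cnf_less x v \<Longrightarrow> \<exists>u. nf u \<and> x = cnf_add v u"
proof (induction v arbitrary: x)
  case (OP a b)
  then obtain c d where x: "x = OP c d" by (cases x) auto
  show ?case
  proof (cases "cnf_less a c")
    case True
    then show ?thesis using OP x by (intro exI[of _ x]) auto
  next
    case False
    then have c: "c = a" "\<not> cnf_less d b" using OP x cnf_less_linear[of a c] by auto
    then obtain u where u: "nf u" "d = cnf_add b u" using OP x by auto
    then have "lead_le u a" using OP x c lead_le_add_right[of b u a] by auto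
    then have "x = cnf_add (OP a b) u" using x c u by (cases u) auto
    then show ?thesis using u by blast
  qed
qed auto

lemma eps0_less_add_iff:
  fixes v w x :: eps0
  shows "x < v + w \<longleftrightarrow> x < v \<or> (\<exists>u<w. x = v + u)"
proof -
  have mono: "v + a < v + b" if "a < b" for a b
    using that by transfer (rule cnf_add_mono)
  have v0: "v + 0 = v" by transfer simp
  have ge: "v \<le> v + w" using mono[of 0 w] v0 eps0_zero_le[of w] by (cases "w = 0") (auto simp: order_less_le)
  have diff: "\<exists>u. x = v + u" if "\<not> x < v"
    using that by transfer (use cnf_diff_ex in auto)
  have iff: "v + a < v + w \<longleftrightarrow> a < w" for a
    using mono[of a w] mono[of w a] by (cases a w rule: linorder_cases) auto
  show ?thesis using diff iff ge by (metis order_less_le_trans)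
qed

lemma eps0_less_omega_pow_iff:
  fixes v x :: eps0
  shows "x < omega_pow v \<longleftrightarrow> x = 0 \<or> (\<exists>w<v. \<exists>n. x < (((+) (omega_pow w)) ^^ n) 0)"
proof -
  let ?mul = "\<lambda>w n. ((cnf_add (OP w OZ)) ^^ n) OZ"
  have rep: "Rep_eps0 ((((+) (omega_pow w)) ^^ n) 0) = ?mul (Rep_eps0 w) n" for w n
    by (induction n) (simp_all add: zero_eps0.rep_eq plus_eps0.rep_eq omega_pow.rep_eq)
  have lead: "lead_le (?mul w n) w" for w n
    by (induction n) (auto intro: lead_le_add)
  have Suc: "?mul w (Suc n) = OP w (?mul w n)" for w n
    using lead[of n w] by (cases "?mul w n") auto
  have below: "\<exists>n. cnf_less x (?mul w n)" if "nf x" "lead_le x w" for x w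
    using that
  proof (induction x)
    case OZ
    have "cnf_less OZ (?mul w (Suc 0))" by simp
    then show ?case by blast
  next
    case (OP e f)
    show ?case
    proof (cases "cnf_less e w")
      case True
      then have "cnf_less (OP e f) (?mul w (Suc 0))" by simp
      then show ?thesis by blast
    next
      case False
      then have "e = w" using OP cnf_less_linear[of e w] by auto
      moreover obtain n where "cnf_less f (?mul w n)" using OP \<open>e = w\<close> by auto
      ultimately have "cnf_less (OP e f) (?mul w (Suc n))" unfolding Suc by simp
      then show ?thesis by blast
    qed
  qed
  have up: "x = 0 \<or> (\<exists>w<v. \<exists>n. x < (((+) (omega_pow w)) ^^ n) 0)" if "x < omega_pow v"
  proof (cases "Rep_eps0 x")
    case OZ
    then show ?thesis by (metis Rep_eps0_inject zero_eps0.rep_eq)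
  next
    case (OP c d)
    have nfx: "nf (OP c d)" using Rep_eps0[of x] OP by simp
    have cv: "cnf_less c (Rep_eps0 v)"
      using that OP by (auto simp: less_eps0.rep_eq omega_pow.rep_eq)
    obtain w where w: "Rep_eps0 w = c"
      using nfx by (metis Abs_eps0_inverse mem_Collect_eq nf.simps(2))
    obtain n where "cnf_less (OP c d) (?mul c n)" using below[OF nfx, of c] by auto
    then have "x < (((+) (omega_pow w)) ^^ n) 0" unfolding less_eps0.rep_eq rep OP w .
    moreover have "w < v" using cv w by (simp add: less_eps0.rep_eq)
    ultimately show ?thesis by blast
  qed
  have "(0::eps0) < omega_pow v" by transfer simp
  moreover have "(((+) (omega_pow w)) ^^ n) 0 < omega_pow v" if "w < v" for w n
    unfolding less_eps0.rep_eq rep omega_pow.rep_eq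
    using lead lead_less that less_eps0.rep_eq by blast
  ultimately show ?thesis using up by (metis order_less_trans)
qed

lemma eps0_towers_cofinal: "\<exists>n. x < (omega_pow ^^ n) 0"
proof -
  have rep: "Rep_eps0 ((omega_pow ^^ n) 0) = ((\<lambda>a. OP a OZ) ^^ n) OZ" for n
    by (induction n) (simp_all add: zero_eps0.rep_eq omega_pow.rep_eq)
  have "\<exists>n. cnf_less x (((\<lambda>a. OP a OZ) ^^ n) OZ)" for x
  proof (induction x)
    case OZ
    have "cnf_less OZ (((\<lambda>a. OP a OZ) ^^ Suc 0) OZ)" by simp
    then show ?case by blast
  next
    case (OP a b)
    then obtain n where "cnf_less a (((\<lambda>a. OP a OZ) ^^ n) OZ)" by blast
    then have "cnf_less (OP a b) (((\<lambda>a. OP a OZ) ^^ Suc n) OZ)" by simp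
    then show ?case by blast
  qed
  then show ?thesis unfolding less_eps0.rep_eq rep .
qed

datatype ('f, 'v) trm = Var 'v | Fun 'f "('f, 'v) trm list"

text \<open>
  In the definitions below, \<open>F\<close> is the set of AC symbols and \<open>gt\<close> the
  precedence on function symbols.
\<close>

inductive ac_eq :: "'f set \<Rightarrow> ('f, 'v) trm \<Rightarrow> ('f, 'v) trm \<Rightarrow> bool" for F where
  ac_assoc: "f \<in> F \<Longrightarrow> ac_eq F (Fun f [Fun f [s, t], u]) (Fun f [s, Fun f [t, u]])"
| ac_comm: "f \<in> F \<Longrightarrow> ac_eq F (Fun f [s, t]) (Fun f [t, s])"
| ac_refl: "ac_eq F s s"
| ac_sym: "ac_eq F s t \<Longrightarrow> ac_eq F t s"
| ac_trans: "ac_eq F s t \<Longrightarrow> ac_eq F t u \<Longrightarrow> ac_eq F s u"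
| ac_cong: "ac_eq F s t \<Longrightarrow> ac_eq F (Fun f (us @ s # vs)) (Fun f (us @ t # vs))"

inductive ac_eq_mul :: "'f set \<Rightarrow> ('f, 'v) trm multiset \<Rightarrow> ('f, 'v) trm multiset \<Rightarrow> bool"
  for F where
  "ac_eq_mul F {#} {#}"
| "ac_eq F s t \<Longrightarrow> ac_eq_mul F M N \<Longrightarrow> ac_eq_mul F ({#s#} + M) ({#t#} + N)"

fun TF_sym :: "'f set \<Rightarrow> 'f \<Rightarrow> ('f, 'v) trm \<Rightarrow> ('f, 'v) trm multiset" where
  "TF_sym F f (Fun g [u1, u2]) =
     (if g = f \<and> f \<in> F then TF_sym F f u1 + TF_sym F f u2 else {#Fun g [u1, u2]#})"
| "TF_sym F f u = {#u#}"

text \<open>Top-flattening is meant for non-variable terms only; it is never used on variables.\<close>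

fun TF :: "'f set \<Rightarrow> ('f, 'v) trm \<Rightarrow> ('f, 'v) trm multiset" where
  "TF F (Fun f ts) = sum_list (map (TF_sym F f) ts)"
| "TF F (Var x) = {#}"

text \<open>
  Variables are incomparable to function symbols in the precedence, so a
  comparison \<open>root s > root t\<close> or \<open>root s = root t\<close> with \<open>s\<close> not a variable
  forces \<open>t\<close> to be of the form \<open>Fun g ts\<close>. The recursive calls go to pairs with
  smaller total size, so the least fixed point is the only one.
\<close>

inductive acmpo ::
  "'f set \<Rightarrow> ('f \<Rightarrow> 'f \<Rightarrow> bool) \<Rightarrow> ('f, 'v) trm \<Rightarrow> ('f, 'v) trm \<Rightarrow> bool"
  for F gt where
  acmpo_sub:
    "s' \<in># TF F (Fun f ss) \<Longrightarrow> acmpo F gt s' t \<or> ac_eq F s' t \<Longrightarrow>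
     acmpo F gt (Fun f ss) t"
| acmpo_prec:
    "gt f g \<Longrightarrow> \<forall>t' \<in># TF F (Fun g ts). acmpo F gt (Fun f ss) t' \<Longrightarrow>
     acmpo F gt (Fun f ss) (Fun g ts)"
| acmpo_mul:
    "TF F (Fun f ss) = S1 + S2 \<Longrightarrow> TF F (Fun f ts) = T1 + T2 \<Longrightarrow>
     ac_eq_mul F S1 T1 \<Longrightarrow> S2 \<noteq> {#} \<Longrightarrow>
     \<forall>t' \<in># T2. \<exists>s' \<in># S2. acmpo F gt s' t' \<Longrightarrow>
     acmpo F gt (Fun f ss) (Fun f ts)"

datatype hsym =
  sym_h | sym_0 | sym_I | sym_E | sym_s | sym_C | sym_D
  | sym_A eps0 | sym_B eps0 | sym_bar

text \<open>
  The type of terms does not enforce arities. This is harmless: \<open>rules_wf_trm\<close>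
  below shows that all rules respect them, \<open>TF\<close> and the recursive calls of
  \<open>acmpo\<close> only produce subterms, and \<open>ac_eq\<close> never leaves the set of terms
  that respect arities.
\<close>

fun arity :: "hsym \<Rightarrow> nat" where
  "arity sym_h = 0"
| "arity sym_0 = 0"
| "arity sym_I = 1"
| "arity sym_E = 1"
| "arity sym_s = 1"
| "arity sym_C = 2"
| "arity sym_D = 2"
| "arity (sym_A v) = 2"
| "arity (sym_B v) = 2"
| "arity sym_bar = 2"

fun wf_trm :: "(hsym, 'v) trm \<Rightarrow> bool" where
  "wf_trm (Var x) = True"
| "wf_trm (Fun f ts) = (length ts = arity f \<and> (\<forall>t \<in> set ts. wf_trm t))"

definition hAC :: "hsym set" where
  "hAC = {sym_bar}"

inductive hprec_base :: "hsym \<Rightarrow> hsym \<Rightarrow> bool" where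
  "v > w \<Longrightarrow> hprec_base (sym_A v) (sym_A w)"
| "v > w \<Longrightarrow> hprec_base (sym_B v) (sym_B w)"
| "hprec_base (sym_B (v + 1)) (sym_A v)"
| "hprec_base (sym_A v) (sym_B v)"
| "hprec_base (sym_B 0) sym_s"
| "hprec_base sym_s sym_D"
| "hprec_base sym_D sym_C"
| "hprec_base sym_C sym_I"
| "hprec_base sym_I sym_E"
| "hprec_base sym_E sym_bar"

definition hprec :: "hsym \<Rightarrow> hsym \<Rightarrow> bool" where
  "hprec = hprec_base\<^sup>+\<^sup>+"

abbreviation "hh \<equiv> Fun sym_h []"
abbreviation "h0 \<equiv> Fun sym_0 []"
abbreviation "hI t \<equiv> Fun sym_I [t]"
abbreviation "hE t \<equiv> Fun sym_E [t]"
abbreviation "hs t \<equiv> Fun sym_s [t]"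
abbreviation "hC t u \<equiv> Fun sym_C [t, u]"
abbreviation "hD t u \<equiv> Fun sym_D [t, u]"
abbreviation "hA v t u \<equiv> Fun (sym_A v) [t, u]"
abbreviation "hB v t u \<equiv> Fun (sym_B v) [t, u]"
abbreviation hbar (infixr "\<parallel>" 65) where "t \<parallel> u \<equiv> Fun sym_bar [t, u]"
abbreviation "vn \<equiv> Var ''n''"
abbreviation "vx \<equiv> Var ''x''"
abbreviation "vy \<equiv> Var ''y''"

inductive_set H_lab :: "((hsym, string) trm \<times> (hsym, string) trm) set" where
  "(hA omega vn (hI hh), hA 1 (hs vn) hh) \<in> H_lab"
| "(hA (omega_pow (v + 1)) vn (hI (hh \<parallel> vx)), hA (omega_pow v) (hs vn) (hI vx)) \<in> H_lab"
| "(hA (omega_pow v) vn (hI vx), hB (omega_pow v) vn (hD (hs vn) (hI vx))) \<in> H_lab"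
| "(hC h0 vx, hE vx) \<in> H_lab"
| "(hC (hs vn) vx, vx \<parallel> hC vn vx) \<in> H_lab"
| "(hI (hE vx \<parallel> vy), hE (hI (vx \<parallel> vy))) \<in> H_lab"
| "(hI (hE vx), hE (hI vx)) \<in> H_lab"
| "(hD vn (hI (hI vx)), hI (hD vn (hI vx))) \<in> H_lab"
| "(hD vn (hI (hI vx \<parallel> vy)), hI (hD vn (hI vx) \<parallel> vy)) \<in> H_lab"
| "(hD vn (hI (hI (hh \<parallel> vx) \<parallel> vy)), hI (hC vn (hI vx) \<parallel> vy)) \<in> H_lab"
| "(hD vn (hI (hI (hh \<parallel> vx))), hI (hC vn (hI vx))) \<in> H_lab"
| "(hD vn (hI (hI hh \<parallel> vy)), hI (hC vn hh \<parallel> vy)) \<in> H_lab"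
| "(hD vn (hI (hI hh)), hI (hC vn hh)) \<in> H_lab"
| "(hB (v + 1) vn (hE vx), hA v (hs vn) vx) \<in> H_lab"

inductive_set Dec :: "((hsym, string) trm \<times> (hsym, string) trm) set" where
  "v > w \<Longrightarrow> (hA v vn vx, hA w vn vx) \<in> Dec"
| "v > w \<Longrightarrow> (hB v vn vx, hB w vn vx) \<in> Dec"

lemma rules_wf_trm: "(l, r) \<in> H_lab \<union> Dec \<Longrightarrow> wf_trm l \<and> wf_trm r"
  by (auto elim!: H_lab.cases Dec.cases)

end

theory Submission
  imports Defs
begin

text \<open>
  Most rules go down in the precedence at the root, which leaves comparisons with
  proper subterms of the right-hand side; these either occur in the left-hand side
  or have a smaller root as well. The multiset case is needed only when the same
  symbol occurs on both sides, as in \<open>C(s(n), x) \<succ> C(n, x)\<close>, \<open>I(E(x)) \<succ> I(x)\<close> and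
  \<open>D(n, I(I(x))) \<succ> D(n, I(x))\<close>, and there it suffices to replace a single argument
  by a smaller one.
\<close>

lemma TF_sym_free: "f \<notin> F \<or> g \<noteq> f \<Longrightarrow> TF_sym F f (Fun g us) = {#Fun g us#}"
  by (rule TF_sym.cases[of "(F, f, Fun g us)"]) auto

lemma TF_sym_not_AC: "f \<notin> F \<Longrightarrow> TF_sym F f u = {#u#}"
  by (cases u) (simp_all add: TF_sym_free)

lemma ac_eq_mul_refl: "ac_eq_mul F M M"
proof (induction M)
  case (add s M)
  then show ?case using ac_eq_mul.intros(2)[OF ac_refl, of F M M s] by simp
qed (simp add: ac_eq_mul.intros)

lemma acmpo_sub_eq: "t \<in># TF F (Fun f ss) \<Longrightarrow> acmpo F gt (Fun f ss) t"
  by (blast intro: acmpo_sub ac_refl)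

lemma acmpo_sub_gt: "acmpo F gt s' t \<Longrightarrow> s' \<in># TF F (Fun f ss) \<Longrightarrow> acmpo F gt (Fun f ss) t"
  by (blast intro: acmpo_sub)

text \<open>The shared part \<open>M\<close> serves as both \<open>S1\<close> and \<open>T1\<close>,
  leaving singletons for \<open>S2\<close> and \<open>T2\<close>.\<close>

lemma acmpo_single:
  assumes "TF F (Fun f ss) = add_mset s M" "TF F (Fun f ts) = add_mset t M" "acmpo F gt s t"
  shows "acmpo F gt (Fun f ss) (Fun f ts)"
  by (rule acmpo_mul[where ?S1.0 = M and ?S2.0 = "{#s#}" and ?T1.0 = M and ?T2.0 = "{#t#}"])
    (use assms ac_eq_mul_refl in auto)

lemma hprec_trans: "hprec f g \<Longrightarrow> hprec g k \<Longrightarrow> hprec f k"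
  unfolding hprec_def by (rule tranclp_trans)

lemma hprec_baseI: "hprec_base f g \<Longrightarrow> hprec f g"
  unfolding hprec_def by (rule tranclp.r_into_trancl)

lemmas hprec_intros = hprec_base.intros[THEN hprec_baseI]

lemma hprec_chain:
  "hprec sym_D sym_C" "hprec sym_C sym_I" "hprec sym_I sym_E" "hprec sym_E sym_bar"
  "hprec sym_I sym_bar" "hprec sym_C sym_E" "hprec sym_C sym_bar"
  "hprec sym_D sym_I" "hprec sym_D sym_bar"
  by (blast intro: hprec_intros hprec_trans)+

lemma hprec_B: "hprec (sym_B v) sym_s" "hprec (sym_B v) sym_D" "hprec (sym_B v) sym_I"
proof -
  \<comment> \<open>Only \<open>sym_B 0\<close> has a base edge to \<open>sym_s\<close>; any other
    \<open>sym_B v\<close> descends to it first.\<close>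
  show s: "hprec (sym_B v) sym_s"
    using eps0_zero_le[of v] hprec_intros(5) hprec_intros(2)[of 0 v] hprec_trans
    by (cases "v = 0") (auto simp: order_less_le)
  show D: "hprec (sym_B v) sym_D"
    by (rule hprec_trans[OF s hprec_intros(6)])
  show "hprec (sym_B v) sym_I"
    by (rule hprec_trans[OF D hprec_chain(8)])
qed

lemma hprec_A: "hprec (sym_A v) sym_s" "hprec (sym_A v) sym_D" "hprec (sym_A v) sym_I"
  using hprec_B hprec_intros(4) hprec_trans by blast+

lemma omega_pow_less_Suc: "omega_pow v < omega_pow (v + 1)"
proof -
  \<comment> \<open>Reading \<open>v\<close> as \<open>v + 0\<close> makes this strict monotonicity
    of addition on the right.\<close>
  have "v + 0 < v + 1"
    by transfer (rule cnf_add_mono, simp)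
  moreover have "v + 0 = v" by transfer simp
  ultimately have "v < v + 1" by simp
  then show ?thesis by transfer simp
qed

lemma one_less_omega: "1 < omega"
  unfolding omega_def by transfer simp

lemmas hprec_rules =
  hprec_chain hprec_A hprec_B hprec_intros(3,4)
  hprec_intros(1)[OF omega_pow_less_Suc] hprec_intros(1)[OF one_less_omega]

abbreviation gt_h (infix "\<succ>" 50) where "s \<succ> t \<equiv> acmpo hAC hprec s t"

lemma TF_sym_hAC:
  "f \<noteq> sym_bar \<Longrightarrow> TF_sym hAC f t = {#t#}"
  "g \<noteq> sym_bar \<Longrightarrow> TF_sym hAC sym_bar (Fun g us) = {#Fun g us#}"
  "TF_sym hAC sym_bar (s \<parallel> t) = TF_sym hAC sym_bar s + TF_sym hAC sym_bar t"
  by (simp_all add: hAC_def TF_sym_not_AC TF_sym_free)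

lemma unary_sub:
  "f \<noteq> sym_bar \<Longrightarrow> Fun f [s] \<succ> s"
  "f \<noteq> sym_bar \<Longrightarrow> s \<succ> u \<Longrightarrow> Fun f [s] \<succ> u"
  by (auto simp: TF_sym_hAC intro: acmpo_sub_eq acmpo_sub_gt)

lemma binary_sub:
  "f \<noteq> sym_bar \<Longrightarrow> Fun f [s, t] \<succ> s"
  "f \<noteq> sym_bar \<Longrightarrow> Fun f [s, t] \<succ> t"
  "f \<noteq> sym_bar \<Longrightarrow> s \<succ> u \<Longrightarrow> Fun f [s, t] \<succ> u"
  "f \<noteq> sym_bar \<Longrightarrow> t \<succ> u \<Longrightarrow> Fun f [s, t] \<succ> u"
  by (auto simp: TF_sym_hAC intro: acmpo_sub_eq acmpo_sub_gt)

text \<open>Flattening keeps an argument of \<open>\<parallel>\<close> whole if its root is not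
  \<open>sym_bar\<close> or if it is a variable; the other argument \<open>t\<close> may
  split.\<close>

lemma bar_sub:
  "g \<noteq> sym_bar \<Longrightarrow> Fun g us \<parallel> t \<succ> Fun g us"
  "g \<noteq> sym_bar \<Longrightarrow> Fun g us \<succ> u \<Longrightarrow> Fun g us \<parallel> t \<succ> u"
  "t \<parallel> Var x \<succ> Var x"
  by (auto simp: TF_sym_hAC intro: acmpo_sub_eq acmpo_sub_gt)

lemmas sub_rules = unary_sub binary_sub bar_sub

lemma unary_mono: "f \<noteq> sym_bar \<Longrightarrow> s \<succ> t \<Longrightarrow> Fun f [s] \<succ> Fun f [t]"
  by (rule acmpo_single[where M = "{#}"]) (simp_all add: TF_sym_hAC)

lemma binary_mono:
  "f \<noteq> sym_bar \<Longrightarrow> s \<succ> t \<Longrightarrow> Fun f [s, u] \<succ> Fun f [t, u]"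
  "f \<noteq> sym_bar \<Longrightarrow> s \<succ> t \<Longrightarrow> Fun f [u, s] \<succ> Fun f [u, t]"
  by (rule acmpo_single[where M = "{#u#}"]; simp add: TF_sym_hAC)+

text \<open>Meant for E(x) | y against x | y below I. Variables do not flatten, so both sides are
  pairs sharing \<open>Var y\<close>.\<close>

lemma bar_mono: "g \<noteq> sym_bar \<Longrightarrow> Fun g us \<succ> Var x \<Longrightarrow> Fun g us \<parallel> Var y \<succ> Var x \<parallel> Var y"
  by (rule acmpo_single[where M = "{#Var y#}" and t = "Var x"]) (simp_all add: TF_sym_hAC)

lemmas mono_rules = unary_mono binary_mono bar_mono

lemmas prec_rules = hprec_rules[THEN acmpo_prec[where F = hAC and gt = hprec]]

theorem theorem5p7:
  "H_lab \<union> Dec \<subseteq> {(s, t). acmpo hAC hprec s t}"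
proof -
  have "s \<succ> t" if "(s, t) \<in> H_lab" for s t
    using that
    \<comment> \<open>Root descents are applied eagerly; choosing between a subterm and a smaller
      argument is left to backtracking.\<close>
    by cases (fastforce simp: TF_sym_hAC intro!: prec_rules intro: sub_rules mono_rules)+
  moreover have "s \<succ> t" if "(s, t) \<in> Dec" for s t
    using that
    \<comment> \<open>The index drops from \<open>v\<close> to \<open>w\<close>, so the roots
      decrease, and both right-hand arguments occur on the left.\<close>
    by cases (auto simp: TF_sym_hAC intro!: acmpo_prec hprec_intros intro: binary_sub)
  ultimately show ?thesis by auto
qed

end
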